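(* Let $D\ge 0$, $N=D$, $K\ge D$, and let $y_0,\dots,y_{K+1}\in\Omega$ be samples. Let $\mathcal{A}^{(K)}_N$ be a positive quadrature rule operator with nodes $X^{(K)}_N=\{x_0,\dots,x_N\}$ and weights $W^{(K)}_N=\{w_0,\dots,w_N\}$ such that $$\mathcal{A}^{(K)}_N\varphi_j=\mu^{(K)}_j\quad\text{for } j=0,\dots,D.$$ Then applying the update procedure described in the context (with any choice of the non-trivial null vector $\mathbf{c}$ and either choice $i\in\{1,2\}$) yields a positive quadrature rule operator $\mathcal{A}^{(K+1)}_N$, with at most $N+1$ nodes, such that $$\mathcal{A}^{(K+1)}_N\varphi_j=\mu^{(K+1)}_j\quad\text{for } j=0,\dots,D.$$
   Context: Let $\Omega\subset\mathbb{R}^d$ and let $\varphi_0,\dots,\varphi_D:\Omega\to\mathbb{R}$ be linearly independent polynomials with $\deg\varphi_j\le\deg\varphi_k$ for $j\le k$, where $\varphi_0$ is a (nonzero) constant function. For samples $y_0,y_1,\dots\in\Omega$ the sample moments are $\mu^{(K)}_j=\frac{1}{K+1}\sum_{k=0}^K\varphi_j(y_k)$. A quadrature rule consists of an indexed family of nodes $X_N=\{x_0,\dots,x_N\}\subset\Omega$ and real weights $W_N=\{w_0,\dots,w_N\}$; its operator is $\mathcal{A}_N u=\sum_{k=0}^N u(x_k)w_k$. It is called positive if all its weights are positive. A superscript $(K)$ indicates that the rule was constructed from the samples $y_0,\dots,y_K$. Update procedure. Given $X^{(K)}_N$, $W^{(K)}_N$ with $N=D$ and the next sample $y_{K+1}$: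 1. (Add node.) Set $x_{N+1}=y_{K+1}$, $v_k=\frac{K+1}{K+2}w_k$ for $k=0,\dots,N$, and $v_{N+1}=\frac{1}{K+2}$. 2. (Null vector.) Let $\mathbf{c}=(c_0,\dots,c_{N+1})^{T}\ne\mathbf{0}$ be a null vector of the $(D+1)\times(N+2)$ Vandermonde matrix with entries $\varphi_j(x_k)$, $j=0,\dots,D$, $k=0,\dots,N+1$, i.e. $\sum_{k=0}^{N+1}\varphi_j(x_k)c_k=0$ for $j=0,\dots,D$. 3. (Choose.) Set $\alpha_1=\min\{v_k/c_k : c_k>0\}$ and $\alpha_2=\max\{v_k/c_k : c_k<0\}$ (both are well defined because $\varphi_0$ is a nonzero constant, so $\mathbf{c}$ has both positive and negative entries), and choose $i\in\{1,2\}$. 4. (Remove.) The new rule $\mathcal{A}^{(K+1)}_N$ has as nodes those $x_k$, $k\in\{0,\dots,N+1\}$, with $v_k>\alpha_i c_k$, and the weight of such a node is $v_k-\alpha_i c_k$. *)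

theory Defs
  imports "HOL-Analysis.Analysis" "HOL-Library.Poly_Mapping"
begin

text \<open>A real polynomial in the coordinates indexed by \<open>'d\<close> is a finitely supported map from
  exponent vectors to coefficients. The degree is thus that of the polynomial itself; it stays
  meaningful when a domain is too small to determine a polynomial by its values.\<close>

type_synonym 'd real_mpoly = "('d \<Rightarrow>\<^sub>0 nat) \<Rightarrow>\<^sub>0 real"

definition mpoly_eval :: "('d::finite) real_mpoly \<Rightarrow> real ^ 'd \<Rightarrow> real" where
  "mpoly_eval p x =
     (\<Sum>m\<in>Poly_Mapping.keys p.
        Poly_Mapping.lookup p m * (\<Prod>i\<in>UNIV. (x $ i) ^ Poly_Mapping.lookup m i))"

text \<open>The zero polynomial gets degree 0.\<close>

definition mpoly_degree :: "('d::finite) real_mpoly \<Rightarrow> nat" where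
  "mpoly_degree p =
     Max (insert 0 ((\<lambda>m. \<Sum>i\<in>UNIV. Poly_Mapping.lookup m i) ` Poly_Mapping.keys p))"

text \<open>Linear independence of the family \<open>f 0, \<dots>, f D\<close> of functions restricted to \<open>\<Omega>\<close>;
  in particular a repeated function makes the family dependent.\<close>

definition lin_indep_on :: "'a set \<Rightarrow> nat \<Rightarrow> (nat \<Rightarrow> 'a \<Rightarrow> real) \<Rightarrow> bool" where
  "lin_indep_on \<Omega> D f \<longleftrightarrow>
     (\<forall>a :: nat \<Rightarrow> real. (\<forall>x\<in>\<Omega>. (\<Sum>j\<le>D. a j * f j x) = 0) \<longrightarrow> (\<forall>j\<le>D. a j = 0))"

definition sample_moment :: "('a \<Rightarrow> real) \<Rightarrow> (nat \<Rightarrow> 'a) \<Rightarrow> nat \<Rightarrow> real" where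
  "sample_moment u y K = 1 / (real K + 1) * (\<Sum>k\<le>K. u (y k))"

text \<open>A rule is the list of its (node, weight) pairs, so that nodes form an indexed family
  and may coincide. A rule with nodes \<open>x\<^sub>0, \<dots>, x\<^sub>N\<close> has length \<open>N + 1\<close>.\<close>

type_synonym 'a quad_rule = "('a \<times> real) list"

definition quad_rule_on :: "'a set \<Rightarrow> 'a quad_rule \<Rightarrow> bool" where
  "quad_rule_on \<Omega> Q \<longleftrightarrow> Q \<noteq> [] \<and> fst ` set Q \<subseteq> \<Omega>"

definition positive_rule :: "'a quad_rule \<Rightarrow> bool" where
  "positive_rule Q \<longleftrightarrow> (\<forall>(x, w)\<in>set Q. w > 0)"

definition quad_op :: "'a quad_rule \<Rightarrow> ('a \<Rightarrow> real) \<Rightarrow> real" where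
  "quad_op Q u = (\<Sum>(x, w)\<leftarrow>Q. u x * w)"

definition add_node :: "nat \<Rightarrow> 'a \<Rightarrow> 'a quad_rule \<Rightarrow> 'a quad_rule" where
  "add_node K z Q =
     map (\<lambda>(x, w). (x, (real K + 1) / (real K + 2) * w)) Q @ [(z, 1 / (real K + 2))]"

text \<open>A vector \<open>c\<close> indexed by the nodes \<open>X\<close> is represented by the values of \<open>c\<close> below
  \<open>length X\<close>; its other values are irrelevant.\<close>

definition nontrivial_null_vector ::
    "nat \<Rightarrow> (nat \<Rightarrow> 'a \<Rightarrow> real) \<Rightarrow> 'a list \<Rightarrow> (nat \<Rightarrow> real) \<Rightarrow> bool" where
  "nontrivial_null_vector D f X c \<longleftrightarrow>
     (\<exists>k<length X. c k \<noteq> 0) \<and> (\<forall>j\<le>D. (\<Sum>k<length X. f j (X ! k) * c k) = 0)"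

definition step_alpha :: "nat \<Rightarrow> real list \<Rightarrow> (nat \<Rightarrow> real) \<Rightarrow> real" where
  "step_alpha i v c =
     (if i = 1 then Min {v ! k / c k |k. k < length v \<and> c k > 0}
      else Max {v ! k / c k |k. k < length v \<and> c k < 0})"

definition remove_nodes :: "real \<Rightarrow> (nat \<Rightarrow> real) \<Rightarrow> 'a quad_rule \<Rightarrow> 'a quad_rule" where
  "remove_nodes \<alpha> c R =
     map (\<lambda>k. (fst (R ! k), snd (R ! k) - \<alpha> * c k))
       (filter (\<lambda>k. snd (R ! k) > \<alpha> * c k) [0..<length R])"

definition update_rule ::
    "nat \<Rightarrow> 'a \<Rightarrow> (nat \<Rightarrow> real) \<Rightarrow> nat \<Rightarrow> 'a quad_rule \<Rightarrow> 'a quad_rule" where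
  "update_rule K z c i Q =
     (let R = add_node K z Q in remove_nodes (step_alpha i (map snd R) c) c R)"

end

theory Submission
  imports Defs
begin

text \<open>
  Adding the sample with weight \<open>1 / (K + 2)\<close> and shrinking the old weights by \<open>(K + 1) / (K + 2)\<close>
  reproduces the recursion of the sample means, so the enlarged rule already has the moments
  \<open>\<mu>\<^bsup>(K+1)\<^esup>\<close>; it only has one node too many. The family of weights \<open>v - \<alpha> c\<close>, with \<open>\<alpha>\<close> real, leaves
  all these moments unchanged because \<open>c\<close> is a null vector. The values of \<open>\<alpha>\<close> for which all weights
  are non-negative form an interval around \<open>0\<close>, compact because \<open>c\<close> has entries of both signs (its
  entries sum to zero, by the constant function \<open>\<phi> 0\<close>). The two candidates \<open>\<alpha>\<^sub>1\<close> and \<open>\<alpha>\<^sub>2\<close> are the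
  endpoints of that interval (\<open>step_alpha_boundary\<close>): no weight is negative there and at least one
  vanishes. Dropping the vanishing weights does not affect the operator (\<open>quad_op_remove_nodes\<close>) and
  lowers the number of nodes by at least one (\<open>length_remove_nodes_less\<close>).
\<close>

lemma quad_op_conv_sum:
  "quad_op Q u = (\<Sum>k<length Q. u (fst (Q ! k)) * snd (Q ! k))"
  by (simp add: quad_op_def sum_list_sum_nth case_prod_beta atLeast0LessThan)

lemma length_add_node [simp]: "length (add_node K z Q) = length Q + 1"
  by (simp add: add_node_def)

lemma quad_op_add_node:
  "quad_op (add_node K z Q) u
     = (real K + 1) / (real K + 2) * quad_op Q u + 1 / (real K + 2) * u z"
proof -
  have "(\<Sum>q\<leftarrow>Q. u (fst q) * ((real K + 1) / (real K + 2) * snd q))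
      = (real K + 1) / (real K + 2) * (\<Sum>q\<leftarrow>Q. u (fst q) * snd q)"
    by (subst sum_list_const_mult [symmetric]) (simp only: mult.left_commute)
  then show ?thesis
    by (simp add: quad_op_def add_node_def comp_def case_prod_unfold)
qed

lemma sample_moment_Suc:
  "sample_moment u y (K + 1)
     = (real K + 1) / (real K + 2) * sample_moment u y K + 1 / (real K + 2) * u (y (K + 1))"
proof -
  have "sample_moment u y (K + 1) = 1 / (real K + 2) * ((\<Sum>k\<le>K. u (y k)) + u (y (K + 1)))"
    by (simp add: sample_moment_def)
  moreover have "(\<Sum>k\<le>K. u (y k)) = (real K + 1) * sample_moment u y K"
    by (simp add: sample_moment_def add_eq_0_iff)
  ultimately show ?thesis
    by (simp only: distrib_left mult.assoc times_divide_eq_left mult_1)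
qed

lemma positive_rule_add_node:
  assumes "positive_rule Q"
  shows "positive_rule (add_node K z Q)"
  using assms by (auto simp: positive_rule_def add_node_def)

lemma nodes_add_node: "fst ` set (add_node K z Q) = insert z (fst ` set Q)"
  by (force simp: add_node_def)

lemma exists_neg_and_pos_of_sum_eq_0:
  fixes c :: "'b \<Rightarrow> real"
  assumes "finite A" "sum c A = 0" "\<exists>k\<in>A. c k \<noteq> 0"
  shows "\<exists>k\<in>A. c k < 0" and "\<exists>k\<in>A. c k > 0"
proof -
  show "\<exists>k\<in>A. c k < 0"
    using assms sum_nonneg_eq_0_iff [of A c] by (meson not_le)
  have "sum (\<lambda>k. - c k) A = 0"
    using assms(2) by (simp add: sum_negf)
  then show "\<exists>k\<in>A. c k > 0"
    using assms(1,3) sum_nonneg_eq_0_iff [of A "\<lambda>k. - c k"]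
    by (metis neg_0_le_iff_le neg_equal_0_iff_equal not_le)
qed

text \<open>An entry with \<open>c k > 0\<close> bounds the admissible \<open>\<alpha>\<close> from above by \<open>v ! k / c k\<close>, and one with
  \<open>c k < 0\<close> bounds it from below. The minimum and the maximum of these ratios are therefore the best
  bounds; the former is positive and the latter negative, so at each of them the entries of the other
  sign give no further constraint. An entry where the minimum or maximum is attained becomes zero.\<close>

lemma step_alpha_boundary:
  assumes v: "\<And>k. k < length v \<Longrightarrow> v ! k > 0"
    and neg: "\<exists>k<length v. c k < 0" and pos: "\<exists>k<length v. c k > 0"
  shows "\<And>k. k < length v \<Longrightarrow> step_alpha i v c * c k \<le> v ! k"
    and "\<exists>k<length v. step_alpha i v c * c k = v ! k"
proof -
  let ?\<alpha> = "step_alpha i v c"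
  have "(\<forall>k<length v. ?\<alpha> * c k \<le> v ! k) \<and> (\<exists>k<length v. ?\<alpha> * c k = v ! k)"
  proof (cases "i = 1")
    case True
    define S where "S = {v ! k / c k |k. k < length v \<and> c k > 0}"
    have \<alpha>: "?\<alpha> = Min S" using True by (simp add: step_alpha_def S_def)
    have S: "finite S" "S \<noteq> {}" using pos by (auto simp: S_def)
    obtain m where m: "m < length v" "c m > 0" "?\<alpha> = v ! m / c m"
      using Min_in [OF S] unfolding \<alpha> by (auto simp: S_def)
    have "?\<alpha> * c k \<le> v ! k" if k: "k < length v" for k
    proof (cases "c k > 0")
      case True
      then have "?\<alpha> \<le> v ! k / c k"
        unfolding \<alpha> using k S(1) by (intro Min_le) (auto simp: S_def)
      then show ?thesis using True by (simp add: pos_le_divide_eq)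
    next
      case False
      moreover have "?\<alpha> > 0" using m v by simp
      ultimately have "?\<alpha> * c k \<le> 0" by (simp add: mult_nonneg_nonpos)
      then show ?thesis using v [OF k] by linarith
    qed
    moreover have "?\<alpha> * c m = v ! m" using m by simp
    ultimately show ?thesis using m(1) by blast
  next
    case False
    define S where "S = {v ! k / c k |k. k < length v \<and> c k < 0}"
    have \<alpha>: "?\<alpha> = Max S" using False by (simp add: step_alpha_def S_def)
    have S: "finite S" "S \<noteq> {}" using neg by (auto simp: S_def)
    obtain m where m: "m < length v" "c m < 0" "?\<alpha> = v ! m / c m"
      using Max_in [OF S] unfolding \<alpha> by (auto simp: S_def)
    have "?\<alpha> * c k \<le> v ! k" if k: "k < length v" for k
    proof (cases "c k < 0")
      case True
      then have "v ! k / c k \<le> ?\<alpha>"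
        unfolding \<alpha> using k S(1) by (intro Max_ge) (auto simp: S_def)
      then show ?thesis using True by (simp add: neg_divide_le_eq)
    next
      case False
      moreover have "?\<alpha> < 0" using m v by (simp add: divide_pos_neg)
      ultimately have "?\<alpha> * c k \<le> 0" by (simp add: mult_nonpos_nonneg)
      then show ?thesis using v [OF k] by linarith
    qed
    moreover have "?\<alpha> * c m = v ! m" using m by simp
    ultimately show ?thesis using m(1) by blast
  qed
  then show "\<And>k. k < length v \<Longrightarrow> ?\<alpha> * c k \<le> v ! k" and "\<exists>k<length v. ?\<alpha> * c k = v ! k"
    by blast+
qed

lemma positive_rule_remove_nodes: "positive_rule (remove_nodes \<alpha> c R)"
  by (auto simp: positive_rule_def remove_nodes_def)

lemma nodes_remove_nodes: "fst ` set (remove_nodes \<alpha> c R) \<subseteq> fst ` set R"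
  by (auto simp: remove_nodes_def)

lemma length_remove_nodes_less:
  assumes "k < length R" "\<alpha> * c k = snd (R ! k)"
  shows "length (remove_nodes \<alpha> c R) < length R"
proof -
  have "length (filter (\<lambda>k. snd (R ! k) > \<alpha> * c k) [0..<length R]) < length [0..<length R]"
    using assms by (intro length_filter_less [of k]) auto
  then show ?thesis by (simp add: remove_nodes_def)
qed

text \<open>The hypothesis makes every dropped weight \<open>snd (R ! k) - \<alpha> * c k\<close> vanish, rather than merely be
  non-positive, so the operator may be computed from all the nodes of \<open>R\<close>.\<close>

lemma quad_op_remove_nodes:
  assumes "\<And>k. k < length R \<Longrightarrow> \<alpha> * c k \<le> snd (R ! k)"
  shows "quad_op (remove_nodes \<alpha> c R) u
           = quad_op R u - \<alpha> * (\<Sum>k<length R. u (fst (R ! k)) * c k)"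
proof -
  let ?w = "\<lambda>k. snd (R ! k) - \<alpha> * c k"
  have "quad_op (remove_nodes \<alpha> c R) u
      = (\<Sum>k\<leftarrow>filter (\<lambda>k. snd (R ! k) > \<alpha> * c k) [0..<length R]. u (fst (R ! k)) * ?w k)"
    by (simp add: quad_op_def remove_nodes_def comp_def)
  also have "\<dots> = (\<Sum>k\<leftarrow>[0..<length R]. u (fst (R ! k)) * ?w k)"
    using assms by (intro sum_list_map_filter) force
  also have "\<dots> = (\<Sum>k<length R. u (fst (R ! k)) * ?w k)"
    by (simp add: sum_set_upt_conv_sum_list_nat [symmetric] atLeast0LessThan)
  also have "\<dots> = quad_op R u - \<alpha> * (\<Sum>k<length R. u (fst (R ! k)) * c k)"
    by (simp add: quad_op_conv_sum sum_subtractf sum_distrib_left algebra_simps)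
  finally show ?thesis .
qed

theorem theorem1:
  fixes \<Omega> :: "(real ^ 'd) set"
    and p :: "nat \<Rightarrow> ('d::finite) real_mpoly"
    and \<phi> :: "nat \<Rightarrow> real ^ 'd \<Rightarrow> real"
    and y :: "nat \<Rightarrow> real ^ 'd"
    and Q :: "(real ^ 'd) quad_rule"
    and c :: "nat \<Rightarrow> real"
    and D N K i :: nat
  assumes "\<And>j x. j \<le> D \<Longrightarrow> x \<in> \<Omega> \<Longrightarrow> \<phi> j x = mpoly_eval (p j) x"
    and "\<And>j k. j \<le> k \<Longrightarrow> k \<le> D \<Longrightarrow> mpoly_degree (p j) \<le> mpoly_degree (p k)"
    and "lin_indep_on \<Omega> D \<phi>"
    and "\<exists>a. a \<noteq> 0 \<and> (\<forall>x\<in>\<Omega>. \<phi> 0 x = a)"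
    and "N = D" and "D \<le> K"
    and "\<And>k. k \<le> K + 1 \<Longrightarrow> y k \<in> \<Omega>"
    and "quad_rule_on \<Omega> Q" and "length Q = N + 1" and "positive_rule Q"
    and "\<And>j. j \<le> D \<Longrightarrow> quad_op Q (\<phi> j) = sample_moment (\<phi> j) y K"
    and "nontrivial_null_vector D \<phi> (map fst (add_node K (y (K + 1)) Q)) c"
    and "i \<in> {1, 2}"
  shows "quad_rule_on \<Omega> (update_rule K (y (K + 1)) c i Q)
    \<and> positive_rule (update_rule K (y (K + 1)) c i Q)
    \<and> length (update_rule K (y (K + 1)) c i Q) \<le> N + 1
    \<and> (\<forall>j\<le>D. quad_op (update_rule K (y (K + 1)) c i Q) (\<phi> j)
              = sample_moment (\<phi> j) y (K + 1))"
proof -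
  define R where "R = add_node K (y (K + 1)) Q"
  define v where "v = map snd R"
  define \<alpha> where "\<alpha> = step_alpha i v c"
  have update: "update_rule K (y (K + 1)) c i Q = remove_nodes \<alpha> c R"
    by (simp add: update_rule_def R_def v_def \<alpha>_def Let_def)
  have len_R: "length R = N + 2" and len_v: "length v = length R"
    using assms(9) by (simp_all add: R_def v_def)
  have nodes_R: "fst ` set R \<subseteq> \<Omega>"
    using assms(7,8) by (auto simp: R_def nodes_add_node quad_rule_on_def)
  have v_pos: "v ! k > 0" if "k < length v" for k
  proof -
    have "positive_rule R"
      unfolding R_def by (rule positive_rule_add_node [OF assms(10)])
    then show ?thesis
      using nth_mem [of k R] that by (auto simp: v_def positive_rule_def case_prod_beta)
  qed
  have "nontrivial_null_vector D \<phi> (map fst R) c"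
    using assms(12) by (simp only: R_def)
  then have c_nonzero: "\<exists>k\<in>{..<length v}. c k \<noteq> 0"
    and null: "\<And>j. j \<le> D \<Longrightarrow> (\<Sum>k<length R. \<phi> j (fst (R ! k)) * c k) = 0"
    by (auto simp: nontrivial_null_vector_def len_v)

  obtain a where a: "a \<noteq> 0" "\<And>x. x \<in> \<Omega> \<Longrightarrow> \<phi> 0 x = a"
    using assms(4) by blast
  have "a * (\<Sum>k<length v. c k) = (\<Sum>k<length R. \<phi> 0 (fst (R ! k)) * c k)"
    unfolding sum_distrib_left len_v
    by (intro sum.cong refl) (use nodes_R a(2) in \<open>auto simp: subset_iff\<close>)
  then have "(\<Sum>k<length v. c k) = 0"
    using null [of 0] a(1) by simp
  then have neg: "\<exists>k<length v. c k < 0" and pos: "\<exists>k<length v. c k > 0"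
    using exists_neg_and_pos_of_sum_eq_0 [OF finite_lessThan _ c_nonzero] by auto
  have nonneg: "\<alpha> * c k \<le> snd (R ! k)" if "k < length R" for k
    using step_alpha_boundary(1) [OF v_pos neg pos, of k i] that by (simp add: \<alpha>_def v_def)
  obtain m where m: "m < length R" "\<alpha> * c m = snd (R ! m)"
    using step_alpha_boundary(2) [OF v_pos neg pos, of i] by (auto simp: \<alpha>_def v_def)

  have moments: "quad_op (remove_nodes \<alpha> c R) (\<phi> j) = sample_moment (\<phi> j) y (K + 1)"
    if "j \<le> D" for j
  proof -
    have "quad_op (remove_nodes \<alpha> c R) (\<phi> j) = quad_op R (\<phi> j)"
      using quad_op_remove_nodes [OF nonneg] null [OF that] by simp
    then show ?thesis
      by (simp only: R_def quad_op_add_node sample_moment_Suc assms(11) [OF that])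
  qed
  \<comment> \<open>The moment of the nonzero constant \<open>\<phi> 0\<close> rules out that all weights vanish at once.\<close>
  have "sample_moment (\<phi> 0) y (K + 1) = a"
  proof -
    have "(\<Sum>k\<le>K + 1. \<phi> 0 (y k)) = (real K + 2) * a"
      using a(2) assms(7) by simp
    then show ?thesis by (simp add: sample_moment_def field_simps)
  qed
  then have "remove_nodes \<alpha> c R \<noteq> []"
    using moments [of 0] a(1) by (auto simp: quad_op_def)
  then have "quad_rule_on \<Omega> (remove_nodes \<alpha> c R)"
    using subset_trans [OF nodes_remove_nodes nodes_R] by (simp add: quad_rule_on_def)
  moreover have "length (remove_nodes \<alpha> c R) \<le> N + 1"
    using length_remove_nodes_less [of m R \<alpha> c] m len_R by simp
  ultimately show ?thesis
    unfolding update using positive_rule_remove_nodes moments by blast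
qed

end
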